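(* Let $N,\mu\ge 1$ be integers and let the discrete-uncertainty multistage setting described in the context be given: finite sets $D_t=\{1,\dots,d_t\}$, matrices $A^{t\tau}\in\mathbf{R}^{m_t\times n_\tau}$ ($1\le\tau\le t\le N$), and right-hand sides $b_t(\xi^t)=\sum_{\tau=1}^t\beta^t_{\tau\xi_{\tau-\mu+1:\tau}}$ that are additive with memory $\mu$. For a collection $u^N=\{u^t_{\tau\xi}\in\mathbf{R}^{n_t}:1\le\tau\le t\le N,\ \xi\in D_{\tau-\mu+1:\tau}\}$ let $x_t(\xi^t)=\sum_{\tau=1}^t u^t_{\tau\xi_{\tau-\mu+1:\tau}}$, $t=1,\dots,N$, be the associated additive with memory $\mu$ decision rules. Let $\mathcal{S}$ be the following system of linear constraints in the variables $u^N$, $y^t_{s\xi}\in\mathbf{R}^{m_t}$ ($1\le s\le t\le N$, $\xi\in D_{s-\mu+1:s}$), and $z$-variables with values in $\mathbf{R}^{m_t}$ (inequalities between vectors are entrywise): (a) $y^t_{s\xi}=\sum_{\tau=s}^tA^{t\tau}u^\tau_{s\xi}-\beta^t_{s\xi}$ for all $1\le s\le t\le N$ and $\xi\in D_{s-\mu+1:s}$; (b) if $\mu=1$: the $z$-variables are $z^t_s$, $1\le s\le t\le N$, and for every $t\in\{1,\dots,N\}$, with $z^t_{t+1}:=0$, $$z^t_s\ge y^t_{s\xi}+z^t_{s+1}\quad\forall \xi\in D_s,\ s=t,t-1,\dots,1,\qquad z^t_1\le 0;$$ (c) if $\mu\ge 2$: the $z$-variables are $z^t_{s\eta}$, $1\le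 s\le t\le N$, $\eta\in D_{s-\mu+1:s-1}$, and for every $t\in\{1,\dots,N\}$, $$z^t_{t\,\xi_{t-\mu+1:t-1}}\ge y^t_{t\,\xi_{t-\mu+1:t}}\quad\forall \xi_{t-\mu+1:t}\in D_{t-\mu+1:t},$$ $$z^t_{s\,\xi_{s-\mu+1:s-1}}\ge y^t_{s\,\xi_{s-\mu+1:s}}+z^t_{(s+1)\,\xi_{s-\mu+2:s}}\quad\forall \xi_{s-\mu+1:s}\in D_{s-\mu+1:s},\ s=t-1,t-2,\dots,1,$$ $$z^t_{1\,\xi_{2-\mu:0}}\le 0.$$ Then $u^N$ satisfies $$\sum_{\tau=1}^tA^{t\tau}x_\tau(\xi^\tau)\le b_t(\xi^t)\qquad\text{for all } t\in\{1,\dots,N\}\text{ and all }\xi^N\in D^N$$ if and only if $u^N$ can be extended, by suitable values of the $y$- and $z$-variables, to a feasible solution of $\mathcal{S}$. Consequently, for a convex objective $f(u^N)$, minimizing $f(u^N)$ over the additive with memory $\mu$ decision rules satisfying these constraints is equivalent to minimizing $f(u^N)$ over all $(u,y,z)$ satisfying the explicit linear system $\mathcal{S}$. Moreover, if $d_t\le d$, $m_t\le m$ and $n_t\le n$ for all $t$, then the total number of scalar variables and the total number of scalar constraints in $\mathcal{S}$ do not exceed $C(m+n)N^2d^\mu$, where $C$ is an absolute constant.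
   Context: Setting. Uncertainty at stage $t\in\{1,\dots,N\}$ is $\xi_t\in D_t=\{1,\dots,d_t\}$, with $d_t\ge1$. Write $D^t=D_1\times\dots\times D_t$ and $\xi^t=(\xi_1,\dots,\xi_t)\in D^t$; for $\xi^N\in D^N$, $\xi^t$ denotes its initial fragment of length $t$. By convention, for indices $s\le0$, $D_s=\{1\}$ and $\xi_s=1$. For $p\le q\le N$, $D_{p:q}=D_p\times D_{p+1}\times\dots\times D_q$ and $\xi_{p:q}=(\xi_p,\dots,\xi_q)$. Decisions at stage $t$ are vectors $x_t=x_t(\xi^t)\in\mathbf{R}^{n_t}$. A function $g:D^t\to\mathbf{R}^\nu$ is additive with memory $\mu$ if $g(\xi_1,\dots,\xi_t)=\sum_{\tau=1}^tu_{\tau\xi_{\tau-\mu+1:\tau}}$ for some coefficients $u_{\tau\xi}\in\mathbf{R}^\nu$, $1\le\tau\le t$, $\xi\in D_{\tau-\mu+1:\tau}$. The right-hand sides $b_t:D^t\to\mathbf{R}^{m_t}$ are additive with memory $\mu$, with given coefficients $\beta^t_{\tau\xi}\in\mathbf{R}^{m_t}$, $1\le\tau\le t\le N$, $\xi\in D_{\tau-\mu+1:\tau}$. *)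

theory Defs
  imports
    Complex_Main
    "HOL-Library.FuncSet"
    "HOL-Library.Extended_Real"
    "Jordan_Normal_Form.Matrix"
begin

section \<open>Discrete uncertainty and additive functions with memory\<close>

text \<open>
  Stages \<open>1, \<dots>, N\<close> are natural numbers, but windows such as \<open>\<tau> - \<mu> + 1, \<dots>, \<tau>\<close> may reach
  nonpositive indices, so a sequence \<open>\<xi>\<^bsub>p:q\<^esub>\<close> is an extensional function on the integer
  interval \<open>{p..q}\<close> (the value is \<open>undefined\<close> outside of it).
\<close>

type_synonym path = "int \<Rightarrow> nat"

definition stage_set :: "(nat \<Rightarrow> nat) \<Rightarrow> int \<Rightarrow> nat set" where
  "stage_set d s = (if s \<le> 0 then {1} else {1..d (nat s)})"

definition paths :: "(nat \<Rightarrow> nat) \<Rightarrow> int \<Rightarrow> int \<Rightarrow> path set" where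
  "paths d p q = (\<Pi>\<^sub>E s\<in>{p..q}. stage_set d s)"

text \<open>The fragment \<open>\<xi>\<^bsub>p:q\<^esub>\<close> of \<open>\<xi>\<close>, with the convention \<open>\<xi>\<^sub>s = 1\<close> for \<open>s \<le> 0\<close>.\<close>

definition frag :: "path \<Rightarrow> int \<Rightarrow> int \<Rightarrow> path" where
  "frag \<xi> p q = (\<lambda>s\<in>{p..q}. if s \<le> 0 then 1 else \<xi> s)"

definition window_paths :: "(nat \<Rightarrow> nat) \<Rightarrow> nat \<Rightarrow> nat \<Rightarrow> path set" where
  "window_paths d \<mu> \<tau> = paths d (int \<tau> - int \<mu> + 1) (int \<tau>)"

definition window :: "nat \<Rightarrow> nat \<Rightarrow> path \<Rightarrow> path" where
  "window \<mu> \<tau> \<xi> = frag \<xi> (int \<tau> - int \<mu> + 1) (int \<tau>)"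

text \<open>
  The function on \<open>D\<^sup>t\<close> with values in \<open>\<real>\<^sup>\<nu>\<close> that is additive with memory \<open>\<mu>\<close> and has
  coefficients \<open>c \<tau> \<zeta>\<close>.
\<close>

definition additive :: "nat \<Rightarrow> nat \<Rightarrow> nat \<Rightarrow> (nat \<Rightarrow> path \<Rightarrow> real vec) \<Rightarrow> path \<Rightarrow> real vec" where
  "additive \<mu> \<nu> t c \<xi> = vec \<nu> (\<lambda>i. \<Sum>\<tau>=1..t. c \<tau> (window \<mu> \<tau> \<xi>) $ i)"

definition multistage_data ::
  "nat \<Rightarrow> nat \<Rightarrow> (nat \<Rightarrow> nat) \<Rightarrow> (nat \<Rightarrow> nat) \<Rightarrow> (nat \<Rightarrow> nat) \<Rightarrow>
   (nat \<Rightarrow> nat \<Rightarrow> real mat) \<Rightarrow> (nat \<Rightarrow> nat \<Rightarrow> path \<Rightarrow> real vec) \<Rightarrow> bool" where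
  "multistage_data N \<mu> d m n A \<beta> \<longleftrightarrow>
     1 \<le> N \<and> 1 \<le> \<mu> \<and>
     (\<forall>t\<in>{1..N}. 1 \<le> d t) \<and>
     (\<forall>t\<in>{1..N}. \<forall>\<tau>\<in>{1..t}. A t \<tau> \<in> carrier_mat (m t) (n \<tau>)) \<and>
     (\<forall>t\<in>{1..N}. \<forall>\<tau>\<in>{1..t}. \<forall>\<zeta>\<in>window_paths d \<mu> \<tau>. \<beta> t \<tau> \<zeta> \<in> carrier_vec (m t))"


section \<open>Scalar variables\<close>

text \<open>
  The last argument of each constructor is a 0-based coordinate. \<open>ZOne\<close> names the
  \<open>z\<close>-variables of the case \<open>\<mu> = 1\<close>, \<open>Z\<close> those of the case \<open>\<mu> \<ge> 2\<close>.
\<close>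

datatype svar =
    U nat nat path nat
  | Y nat nat path nat
  | ZOne nat nat nat
  | Z nat nat path nat

type_synonym assignment = "svar \<Rightarrow> real"

definition u_vars :: "nat \<Rightarrow> nat \<Rightarrow> (nat \<Rightarrow> nat) \<Rightarrow> (nat \<Rightarrow> nat) \<Rightarrow> svar set" where
  "u_vars N \<mu> d n =
     {U t \<tau> \<xi> j | t \<tau> \<xi> j. t \<in> {1..N} \<and> \<tau> \<in> {1..t} \<and> \<xi> \<in> window_paths d \<mu> \<tau> \<and> j < n t}"

definition y_vars :: "nat \<Rightarrow> nat \<Rightarrow> (nat \<Rightarrow> nat) \<Rightarrow> (nat \<Rightarrow> nat) \<Rightarrow> svar set" where
  "y_vars N \<mu> d m =
     {Y t s \<xi> i | t s \<xi> i. t \<in> {1..N} \<and> s \<in> {1..t} \<and> \<xi> \<in> window_paths d \<mu> s \<and> i < m t}"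

definition z_vars :: "nat \<Rightarrow> nat \<Rightarrow> (nat \<Rightarrow> nat) \<Rightarrow> (nat \<Rightarrow> nat) \<Rightarrow> svar set" where
  "z_vars N \<mu> d m =
     (if \<mu> = 1 then {ZOne t s i | t s i. t \<in> {1..N} \<and> s \<in> {1..t} \<and> i < m t}
      else {Z t s \<eta> i | t s \<eta> i. t \<in> {1..N} \<and> s \<in> {1..t} \<and>
              \<eta> \<in> paths d (int s - int \<mu> + 1) (int s - 1) \<and> i < m t})"

definition sys_vars ::
  "nat \<Rightarrow> nat \<Rightarrow> (nat \<Rightarrow> nat) \<Rightarrow> (nat \<Rightarrow> nat) \<Rightarrow> (nat \<Rightarrow> nat) \<Rightarrow> svar set" where
  "sys_vars N \<mu> d m n = u_vars N \<mu> d n \<union> y_vars N \<mu> d m \<union> z_vars N \<mu> d m"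

text \<open>Collections \<open>u\<^sup>N\<close> are the points of the coordinate space \<open>\<real>\<^bsup>u_vars\<^esup>\<close>.\<close>

definition u_space :: "nat \<Rightarrow> nat \<Rightarrow> (nat \<Rightarrow> nat) \<Rightarrow> (nat \<Rightarrow> nat) \<Rightarrow> assignment set" where
  "u_space N \<mu> d n = u_vars N \<mu> d n \<rightarrow>\<^sub>E UNIV"

definition u_part ::
  "nat \<Rightarrow> nat \<Rightarrow> (nat \<Rightarrow> nat) \<Rightarrow> (nat \<Rightarrow> nat) \<Rightarrow> assignment \<Rightarrow> assignment" where
  "u_part N \<mu> d n v = restrict v (u_vars N \<mu> d n)"

definition u_vec :: "(nat \<Rightarrow> nat) \<Rightarrow> assignment \<Rightarrow> nat \<Rightarrow> nat \<Rightarrow> path \<Rightarrow> real vec" where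
  "u_vec n v t \<tau> \<xi> = vec (n t) (\<lambda>j. v (U t \<tau> \<xi> j))"


section \<open>Robust constraints\<close>

definition decision :: "nat \<Rightarrow> (nat \<Rightarrow> nat) \<Rightarrow> assignment \<Rightarrow> nat \<Rightarrow> path \<Rightarrow> real vec" where
  "decision \<mu> n u t \<xi> = additive \<mu> (n t) t (u_vec n u t) \<xi>"

definition rhs ::
  "nat \<Rightarrow> (nat \<Rightarrow> nat) \<Rightarrow> (nat \<Rightarrow> nat \<Rightarrow> path \<Rightarrow> real vec) \<Rightarrow> nat \<Rightarrow> path \<Rightarrow> real vec" where
  "rhs \<mu> m \<beta> t \<xi> = additive \<mu> (m t) t (\<beta> t) \<xi>"

definition robust_feasible ::
  "nat \<Rightarrow> nat \<Rightarrow> (nat \<Rightarrow> nat) \<Rightarrow> (nat \<Rightarrow> nat) \<Rightarrow> (nat \<Rightarrow> nat) \<Rightarrow>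
   (nat \<Rightarrow> nat \<Rightarrow> real mat) \<Rightarrow> (nat \<Rightarrow> nat \<Rightarrow> path \<Rightarrow> real vec) \<Rightarrow> assignment \<Rightarrow> bool" where
  "robust_feasible N \<mu> d m n A \<beta> u \<longleftrightarrow>
     u \<in> u_space N \<mu> d n \<and>
     (\<forall>t\<in>{1..N}. \<forall>\<xi>\<in>paths d 1 (int N).
        vec (m t) (\<lambda>i. \<Sum>\<tau>=1..t. (A t \<tau> *\<^sub>v decision \<mu> n u \<tau> (frag \<xi> 1 (int \<tau>))) $ i)
          \<le> rhs \<mu> m \<beta> t (frag \<xi> 1 (int t)))"


section \<open>The explicit linear system\<close>

text \<open>
  Each scalar constraint has its own label, so that constraints can be counted; the last
  argument is again the coordinate. \<open>BStep\<close>, \<open>BInit\<close> occur for \<open>\<mu> = 1\<close> and \<open>CTop\<close>, \<open>CStep\<close>,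
  \<open>CInit\<close> for \<open>\<mu> \<ge> 2\<close>. The argument of \<open>CInit\<close> ranges over the singleton \<open>D\<^bsub>2-\<mu>:0\<^esub>\<close>.
\<close>

datatype scon =
    YDef nat nat path nat
  | BStep nat nat path nat
  | BInit nat nat
  | CTop nat path nat
  | CStep nat nat path nat
  | CInit nat path nat

definition sys_cons ::
  "nat \<Rightarrow> nat \<Rightarrow> (nat \<Rightarrow> nat) \<Rightarrow> (nat \<Rightarrow> nat) \<Rightarrow> scon set" where
  "sys_cons N \<mu> d m =
     {YDef t s \<xi> i | t s \<xi> i. t \<in> {1..N} \<and> s \<in> {1..t} \<and> \<xi> \<in> window_paths d \<mu> s \<and> i < m t} \<union>
     (if \<mu> = 1 then
        {BStep t s \<xi> i | t s \<xi> i. t \<in> {1..N} \<and> s \<in> {1..t} \<and> \<xi> \<in> window_paths d \<mu> s \<and> i < m t} \<union>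
        {BInit t i | t i. t \<in> {1..N} \<and> i < m t}
      else
        {CTop t \<xi> i | t \<xi> i. t \<in> {1..N} \<and> \<xi> \<in> window_paths d \<mu> t \<and> i < m t} \<union>
        {CStep t s \<xi> i | t s \<xi> i. t \<in> {1..N} \<and> s \<in> {1..<t} \<and> \<xi> \<in> window_paths d \<mu> s \<and> i < m t} \<union>
        {CInit t \<eta> i | t \<eta> i. t \<in> {1..N} \<and> \<eta> \<in> paths d (2 - int \<mu>) 0 \<and> i < m t})"

fun satisfies ::
  "nat \<Rightarrow> (nat \<Rightarrow> nat) \<Rightarrow> (nat \<Rightarrow> nat \<Rightarrow> real mat) \<Rightarrow> (nat \<Rightarrow> nat \<Rightarrow> path \<Rightarrow> real vec) \<Rightarrow>
   assignment \<Rightarrow> scon \<Rightarrow> bool" where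
  "satisfies \<mu> n A \<beta> v (YDef t s \<xi> i) \<longleftrightarrow>
     v (Y t s \<xi> i) = (\<Sum>\<tau>=s..t. (A t \<tau> *\<^sub>v u_vec n v \<tau> s \<xi>) $ i) - \<beta> t s \<xi> $ i"
| "satisfies \<mu> n A \<beta> v (BStep t s \<xi> i) \<longleftrightarrow>
     v (ZOne t s i) \<ge> v (Y t s \<xi> i) + (if s = t then 0 else v (ZOne t (s + 1) i))"
| "satisfies \<mu> n A \<beta> v (BInit t i) \<longleftrightarrow> v (ZOne t 1 i) \<le> 0"
| "satisfies \<mu> n A \<beta> v (CTop t \<xi> i) \<longleftrightarrow>
     v (Z t t (frag \<xi> (int t - int \<mu> + 1) (int t - 1)) i) \<ge> v (Y t t \<xi> i)"
| "satisfies \<mu> n A \<beta> v (CStep t s \<xi> i) \<longleftrightarrow>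
     v (Z t s (frag \<xi> (int s - int \<mu> + 1) (int s - 1)) i) \<ge>
       v (Y t s \<xi> i) + v (Z t (s + 1) (frag \<xi> (int s - int \<mu> + 2) (int s)) i)"
| "satisfies \<mu> n A \<beta> v (CInit t \<eta> i) \<longleftrightarrow> v (Z t 1 \<eta> i) \<le> 0"

definition sys_feasible ::
  "nat \<Rightarrow> nat \<Rightarrow> (nat \<Rightarrow> nat) \<Rightarrow> (nat \<Rightarrow> nat) \<Rightarrow> (nat \<Rightarrow> nat) \<Rightarrow>
   (nat \<Rightarrow> nat \<Rightarrow> real mat) \<Rightarrow> (nat \<Rightarrow> nat \<Rightarrow> path \<Rightarrow> real vec) \<Rightarrow> assignment \<Rightarrow> bool" where
  "sys_feasible N \<mu> d m n A \<beta> v \<longleftrightarrow>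
     v \<in> sys_vars N \<mu> d m n \<rightarrow>\<^sub>E UNIV \<and>
     (\<forall>c\<in>sys_cons N \<mu> d m. satisfies \<mu> n A \<beta> v c)"


section \<open>Convex objectives\<close>

text \<open>
  \<open>convex_on\<close> needs a type of class \<open>real_vector\<close>, which \<open>assignment\<close> is not; this is the
  same definition for the coordinate space \<open>\<real>\<^bsup>I\<^esup>\<close>, that is \<open>I \<rightarrow>\<^sub>E UNIV\<close>.
\<close>

definition convex_objective :: "svar set \<Rightarrow> (assignment \<Rightarrow> real) \<Rightarrow> bool" where
  "convex_objective I f \<longleftrightarrow>
     (\<forall>u \<in> I \<rightarrow>\<^sub>E UNIV. \<forall>w \<in> I \<rightarrow>\<^sub>E UNIV. \<forall>l::real. 0 \<le> l \<and> l \<le> 1 \<longrightarrow>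
        f (\<lambda>k\<in>I. (1 - l) * u k + l * w k) \<le> (1 - l) * f u + l * f w)"

end

theory Submission
  imports Defs
begin

text \<open>
  Interchanging the sums over \<open>\<tau>\<close> and \<open>s\<close> turns the \<open>i\<close>-th robust constraint at stage \<open>t\<close> into
  \<open>\<Sum>s\<le>t. y\<^sup>t\<^sub>s (\<xi>\<^bsub>s-\<mu>+1:s\<^esub>) \<le> 0\<close> for all \<open>\<xi>\<close>. The maximum of such a sum over \<open>\<xi>\<close> is computed by
  backward dynamic programming, the state before stage \<open>s\<close> being the last \<open>\<mu> - 1\<close> values of \<open>\<xi>\<close>.
  Feasible \<open>z\<close>-variables bound the cost-to-go functions from above, and the cost-to-go functions
  themselves are feasible whenever the constraint holds. For \<open>\<mu> = 1\<close> the only state is the empty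
  fragment, so both forms of the system are instances of one recursion.
\<close>

section \<open>Fragments, windows and sets of paths\<close>

lemma frag_apply: "s \<in> {p..q} \<Longrightarrow> frag \<xi> p q s = (if s \<le> 0 then 1 else \<xi> s)"
  by (simp add: frag_def)

lemma frag_cong:
  assumes "\<And>s. s \<in> {p..q} \<Longrightarrow> 0 < s \<Longrightarrow> \<xi> s = \<zeta> s"
  shows "frag \<xi> p q = frag \<zeta> p q"
  unfolding frag_def using assms by (intro restrict_ext) auto

lemma frag_eqD:
  assumes "frag \<xi> p q = frag \<zeta> p q" "s \<in> {p..q}" "0 < s"
  shows "\<xi> s = \<zeta> s"
  using assms frag_apply[of s p q \<xi>] frag_apply[of s p q \<zeta>] by simp

text \<open>Nonpositive indices are reset to 1 in any case, so a first cut starting at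
  \<open>p' \<le> 1\<close> loses nothing, even when the second cut reaches further back.\<close>

lemma frag_frag:
  assumes "p' \<le> p \<or> p' \<le> 1" "q \<le> q'"
  shows "frag (frag \<xi> p' q') p q = frag \<xi> p q"
  using assms by (intro frag_cong) (auto simp: frag_def)

text \<open>The value 1 that \<open>frag\<close> writes at nonpositive indices is the only element
  of \<open>stage_set\<close> there, and outside the interval both sides are
  \<open>undefined\<close>.\<close>

lemma frag_paths_id:
  assumes "\<xi> \<in> paths d p q"
  shows "frag \<xi> p q = \<xi>"
proof
  fix s show "frag \<xi> p q s = \<xi> s"
    using assms by (auto simp: frag_def paths_def stage_set_def PiE_iff extensional_def split: if_splits)
qed

lemma frag_in_paths:
  assumes "\<And>s. s \<in> {p..q} \<Longrightarrow> 0 < s \<Longrightarrow> \<xi> s \<in> stage_set d s"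
  shows "frag \<xi> p q \<in> paths d p q"
  using assms by (auto simp: frag_def paths_def stage_set_def)

lemma paths_apply: "\<xi> \<in> paths d p q \<Longrightarrow> s \<in> {p..q} \<Longrightarrow> \<xi> s \<in> stage_set d s"
  by (auto simp: paths_def PiE_iff)

lemma frag_eq_path:
  assumes "\<zeta> \<in> paths d p q" "\<And>s. s \<in> {p..q} \<Longrightarrow> 0 < s \<Longrightarrow> \<xi> s = \<zeta> s"
  shows "frag \<xi> p q = \<zeta>"
  using frag_cong[of p q \<xi> \<zeta>] frag_paths_id[OF assms(1)] assms(2) by simp

lemma window_in_window_paths:
  assumes "\<xi> \<in> paths d 1 (int N)" "\<tau> \<le> N"
  shows "window \<mu> \<tau> \<xi> \<in> window_paths d \<mu> \<tau>"
  unfolding window_def window_paths_def using assms(2)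
  by (intro frag_in_paths paths_apply[OF assms(1)]) auto

lemma finite_paths: "finite (paths d p q)"
  by (auto simp: paths_def stage_set_def intro!: finite_PiE)

lemma paths_nonempty:
  assumes "\<forall>t\<in>{1..N}. 1 \<le> d t" "q \<le> int N"
  shows "paths d p q \<noteq> {}"
proof -
  have "stage_set d s \<noteq> {}" if "s \<in> {p..q}" for s
  proof (cases "s \<le> 0")
    case False
    then have "nat s \<in> {1..N}" using that assms(2) by auto
    then show ?thesis using assms(1) False by (auto simp: stage_set_def)
  qed (simp add: stage_set_def)
  then show ?thesis by (simp add: paths_def PiE_eq_empty_iff)
qed

text \<open>For \<open>\<mu> = 1\<close> the state before stage \<open>s\<close> lives on the empty
  interval \<open>{s..s - 1}\<close>; this identifies the single state.\<close>

lemma paths_empty_interval: "q < p \<Longrightarrow> paths d p q = {\<lambda>_. undefined}"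
  by (simp add: paths_def)

section \<open>Backward dynamic programming for one coordinate of one stage\<close>

text \<open>Along a fixed scenario the inequalities telescope, from stage \<open>t\<close>
  backwards: the state that \<open>z (s + 1)\<close> sees after the window at \<open>s\<close> is
  the one from which the next inequality starts.\<close>

lemma tail_sum_le_cost_to_go:
  fixes y z :: "nat \<Rightarrow> path \<Rightarrow> real"
  assumes step: "\<And>s \<zeta>. s \<in> {1..t} \<Longrightarrow> \<zeta> \<in> window_paths d \<mu> s \<Longrightarrow>
      y s \<zeta> + (if s = t then 0 else z (s + 1) (frag \<zeta> (int s - int \<mu> + 2) (int s)))
        \<le> z s (frag \<zeta> (int s - int \<mu> + 1) (int s - 1))"
    and "1 \<le> \<mu>" "1 \<le> s" "s \<le> t" "t \<le> N" "\<xi> \<in> paths d 1 (int N)"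
  shows "(\<Sum>r=s..t. y r (window \<mu> r \<xi>)) \<le> z s (frag \<xi> (int s - int \<mu> + 1) (int s - 1))"
  using \<open>s \<le> t\<close> \<open>1 \<le> s\<close>
proof (induction s rule: inc_induct)
  case base
  have "window \<mu> t \<xi> \<in> window_paths d \<mu> t"
    using assms by (intro window_in_window_paths)
  from step[OF _ this] base show ?case
    by (simp add: window_def frag_frag)
next
  case (step s)
  have "window \<mu> s \<xi> \<in> window_paths d \<mu> s"
    using assms step by (intro window_in_window_paths) auto
  from assms(1)[OF _ this] step have
    "y s (window \<mu> s \<xi>) + z (s + 1) (frag \<xi> (int s - int \<mu> + 2) (int s))
        \<le> z s (frag \<xi> (int s - int \<mu> + 1) (int s - 1))"
    by (simp add: window_def frag_frag)
  moreover have "(\<Sum>r=s..t. y r (window \<mu> r \<xi>)) = y s (window \<mu> s \<xi>) + (\<Sum>r=Suc s..t. y r (window \<mu> r \<xi>))"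
    using step by (simp add: sum.atLeast_Suc_atMost)
  \<comment> \<open>The state before stage \<open>s + 1\<close> occupies the indices from
    \<open>s - \<mu> + 2\<close> to \<open>s\<close>.\<close>
  moreover have "z (Suc s) (frag \<xi> (int (Suc s) - int \<mu> + 1) (int (Suc s) - 1))
      = z (s + 1) (frag \<xi> (int s - int \<mu> + 2) (int s))"
    by (simp add: algebra_simps)
  ultimately show ?case using step.IH step.prems by linarith
qed

text \<open>The witness \<open>z s \<eta>\<close> is the largest tail sum from stage
  \<open>s\<close> on, over all scenarios whose state before \<open>s\<close> is
  \<open>\<eta>\<close>. Taking the maximum makes the recursion hold, and at \<open>s = 1\<close>
  the tail is the whole sum, which is nonpositive by assumption.\<close>

lemma cost_to_go_exists:
  fixes y :: "nat \<Rightarrow> path \<Rightarrow> real"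
  assumes neg: "\<And>\<xi>. \<xi> \<in> paths d 1 (int N) \<Longrightarrow> (\<Sum>r=1..t. y r (window \<mu> r \<xi>)) \<le> 0"
    and d: "\<forall>t\<in>{1..N}. 1 \<le> d t" and "1 \<le> \<mu>" "t \<le> N"
  shows "\<exists>z.
    (\<forall>s\<in>{1..t}. \<forall>\<zeta>\<in>window_paths d \<mu> s.
      y s \<zeta> + (if s = t then 0 else z (s + 1) (frag \<zeta> (int s - int \<mu> + 2) (int s)))
        \<le> z s (frag \<zeta> (int s - int \<mu> + 1) (int s - 1))) \<and>
    (\<forall>\<eta>\<in>paths d (2 - int \<mu>) 0. z 1 \<eta> \<le> 0)"
proof -
  define T where "T s \<xi> = (\<Sum>r=s..t. y r (window \<mu> r \<xi>))" for s \<xi>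
  define P where
    "P s \<eta> = {\<xi> \<in> paths d 1 (int N). frag \<xi> (int s - int \<mu> + 1) (int s - 1) = \<eta>}" for s \<eta>
  define z where "z s \<eta> = Max (T s ` P s \<eta>)" for s \<eta>
  have fin: "finite (P s \<eta>)" for s \<eta>
    by (simp add: P_def finite_paths)
  have ge: "T s \<xi> \<le> z s \<eta>" if "\<xi> \<in> P s \<eta>" for s \<xi> \<eta>
    unfolding z_def using that fin by (intro Max_ge) auto
  have att: "\<exists>\<xi>\<in>P s \<eta>. z s \<eta> = T s \<xi>" if "P s \<eta> \<noteq> {}" for s \<eta>
    using Max_in[of "T s ` P s \<eta>"] that fin unfolding z_def by blast
  obtain \<xi>0 where \<xi>0: "\<xi>0 \<in> paths d 1 (int N)"
    using paths_nonempty[OF d] by blast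
  show ?thesis
  proof (intro exI[of _ z] conjI ballI)
    fix s \<zeta> assume s: "s \<in> {1..t}" and \<zeta>: "\<zeta> \<in> window_paths d \<mu> s"
    let ?\<eta> = "frag \<zeta> (int s - int \<mu> + 2) (int s)"
    \<comment> \<open>A maximizer of the tail after \<open>s\<close> stays one when its window at \<open>s\<close> is replaced by \<open>\<zeta>\<close>,
      because later windows see only the part on which it agrees with \<open>\<zeta>\<close>.\<close>
    define glue where "glue \<xi> = (\<lambda>r. if r \<in> {int s - int \<mu> + 1..int s} \<and> 1 \<le> r then \<zeta> r else \<xi> r)"
      for \<xi> :: path
    have glue: "glue \<xi> \<in> paths d 1 (int N)" if "\<xi> \<in> paths d 1 (int N)" for \<xi>
      using that \<zeta> s \<open>t \<le> N\<close>
      by (auto simp: glue_def paths_def window_paths_def PiE_iff extensional_def)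
    \<comment> \<open>Pasting \<open>\<zeta>\<close> into an arbitrary scenario shows that the state
      \<open>?\<eta>\<close> is reached, so the maximum defining \<open>z (s + 1) ?\<eta>\<close> is
      over a nonempty set and is attained.\<close>
    have "frag (glue \<xi>0) (int (s + 1) - int \<mu> + 1) (int (s + 1) - 1) = ?\<eta>"
      using \<open>1 \<le> \<mu>\<close> by (simp add: algebra_simps, intro frag_cong) (auto simp: glue_def)
    then have "glue \<xi>0 \<in> P (s + 1) ?\<eta>"
      using glue[OF \<xi>0] by (simp add: P_def)
    then obtain \<xi> where \<xi>: "\<xi> \<in> P (s + 1) ?\<eta>" and z: "z (s + 1) ?\<eta> = T (s + 1) \<xi>"
      using att by blast
    have agree: "\<xi> r = \<zeta> r" if "r \<in> {int s - int \<mu> + 2..int s}" "0 < r" for r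
      using \<xi> that by (intro frag_eqD[of _ "int s - int \<mu> + 2" "int s"]) (auto simp: P_def algebra_simps)
    have "glue \<xi> \<in> P s (frag \<zeta> (int s - int \<mu> + 1) (int s - 1))"
      using glue \<xi> by (auto simp: P_def glue_def intro!: frag_cong)
    then have "T s (glue \<xi>) \<le> z s (frag \<zeta> (int s - int \<mu> + 1) (int s - 1))"
      by (rule ge)
    moreover have "window \<mu> s (glue \<xi>) = \<zeta>"
      unfolding window_def using \<zeta>[unfolded window_paths_def]
      by (rule frag_eq_path) (auto simp: glue_def)
    moreover have "window \<mu> r (glue \<xi>) = window \<mu> r \<xi>" if "r \<in> {s + 1..t}" for r
      unfolding window_def using that agree by (intro frag_cong) (auto simp: glue_def)
    then have "T (s + 1) (glue \<xi>) = T (s + 1) \<xi>"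
      by (simp add: T_def)
    moreover have "T s (glue \<xi>) = y s (window \<mu> s (glue \<xi>)) + T (s + 1) (glue \<xi>)"
      unfolding T_def using s by (simp add: sum.atLeast_Suc_atMost)
    \<comment> \<open>The tail after stage \<open>t\<close> is an empty sum, which matches the 0 in
      the recursion at \<open>s = t\<close>.\<close>
    moreover have "T (s + 1) \<xi> = 0" if "s = t"
      using that by (simp add: T_def)
    ultimately show "y s \<zeta> + (if s = t then 0 else z (s + 1) ?\<eta>)
        \<le> z s (frag \<zeta> (int s - int \<mu> + 1) (int s - 1))"
      using z by (cases "s = t") auto
  next
    fix \<eta> assume \<eta>: "\<eta> \<in> paths d (2 - int \<mu>) 0"
    \<comment> \<open>The initial state has only nonpositive indices, so every scenario starts in
      it.\<close>
    have "frag \<xi>0 (2 - int \<mu>) 0 = \<eta>"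
      using \<eta> by (rule frag_eq_path) auto
    then have "P 1 \<eta> \<noteq> {}"
      using \<xi>0 by (auto simp: P_def)
    with att obtain \<xi> where "\<xi> \<in> P 1 \<eta>" "z 1 \<eta> = T 1 \<xi>"
      by blast
    then show "z 1 \<eta> \<le> 0"
      using neg by (simp add: P_def T_def)
  qed
qed

section \<open>Robust constraints as sums of slacks over windows\<close>

text \<open>Linearity of the matrix-vector product; the dimension assumption gives all scalar
  products the same index range, so that the two sums can be swapped.\<close>

lemma mult_mat_vec_additive:
  assumes "A \<in> carrier_mat k \<nu>" "i < k" "\<And>\<tau>. \<tau> \<in> {1..t} \<Longrightarrow> dim_vec (c \<tau> (window \<mu> \<tau> \<xi>)) = \<nu>"
  shows "(A *\<^sub>v additive \<mu> \<nu> t c \<xi>) $ i = (\<Sum>\<tau>=1..t. (A *\<^sub>v c \<tau> (window \<mu> \<tau> \<xi>)) $ i)"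
proof -
  have "(A *\<^sub>v additive \<mu> \<nu> t c \<xi>) $ i =
      (\<Sum>j<\<nu>. \<Sum>\<tau>=1..t. A $$ (i, j) * c \<tau> (window \<mu> \<tau> \<xi>) $ j)"
    using assms by (simp add: additive_def scalar_prod_def sum_distrib_left atLeast0LessThan)
  also have "\<dots> = (\<Sum>\<tau>=1..t. \<Sum>j<\<nu>. A $$ (i, j) * c \<tau> (window \<mu> \<tau> \<xi>) $ j)"
    by (rule sum.swap)
  also have "\<dots> = (\<Sum>\<tau>=1..t. (A *\<^sub>v c \<tau> (window \<mu> \<tau> \<xi>)) $ i)"
    using assms by (intro sum.cong refl) (simp add: scalar_prod_def atLeast0LessThan)
  finally show ?thesis .
qed

text \<open>The value that (a) forces on \<open>y\<^sup>t\<^bsub>s\<zeta>\<^esub>\<close>.\<close>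

definition slack ::
  "(nat \<Rightarrow> nat) \<Rightarrow> (nat \<Rightarrow> nat \<Rightarrow> real mat) \<Rightarrow> (nat \<Rightarrow> nat \<Rightarrow> path \<Rightarrow> real vec) \<Rightarrow>
   assignment \<Rightarrow> nat \<Rightarrow> nat \<Rightarrow> path \<Rightarrow> nat \<Rightarrow> real" where
  "slack n A \<beta> u t s \<zeta> i = (\<Sum>\<tau>=s..t. (A t \<tau> *\<^sub>v u_vec n u \<tau> s \<zeta>) $ i) - \<beta> t s \<zeta> $ i"

text \<open>Windows at stages up to \<open>t\<close> see no positive index beyond \<open>q\<close>,
  so decisions and right-hand sides can be evaluated on the uncut scenario.\<close>

lemma additive_frag:
  assumes "t \<le> q"
  shows "additive \<mu> \<nu> t c (frag \<xi> 1 (int q)) = additive \<mu> \<nu> t c \<xi>"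
  unfolding additive_def window_def using assms by (auto simp: frag_frag intro!: eq_vecI sum.cong)

text \<open>The left-hand side is a sum over the triangle
  \<open>1 \<le> s \<le> \<tau> \<le> t\<close>. Summing over \<open>\<tau>\<close> first collects
  all terms that depend on the window at \<open>s\<close>, and the right-hand side splits over the
  same windows.\<close>

lemma constraint_eq_sum_slack:
  assumes "multistage_data N \<mu> d m n A \<beta>" "t \<in> {1..N}" "i < m t"
  shows "(\<Sum>\<tau>=1..t. (A t \<tau> *\<^sub>v decision \<mu> n u \<tau> (frag \<xi> 1 (int \<tau>))) $ i)
      - rhs \<mu> m \<beta> t (frag \<xi> 1 (int t)) $ i
    = (\<Sum>s=1..t. slack n A \<beta> u t s (window \<mu> s \<xi>) i)"
proof -
  have "(\<Sum>\<tau>=1..t. (A t \<tau> *\<^sub>v decision \<mu> n u \<tau> (frag \<xi> 1 (int \<tau>))) $ i)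
      = (\<Sum>\<tau>=1..t. \<Sum>s=1..\<tau>. (A t \<tau> *\<^sub>v u_vec n u \<tau> s (window \<mu> s \<xi>)) $ i)"
  proof (intro sum.cong refl)
    fix \<tau> assume \<tau>: "\<tau> \<in> {1..t}"
    then have "A t \<tau> \<in> carrier_mat (m t) (n \<tau>)"
      using assms by (auto simp: multistage_data_def)
    with \<tau> assms show "(A t \<tau> *\<^sub>v decision \<mu> n u \<tau> (frag \<xi> 1 (int \<tau>))) $ i
        = (\<Sum>s=1..\<tau>. (A t \<tau> *\<^sub>v u_vec n u \<tau> s (window \<mu> s \<xi>)) $ i)"
      unfolding decision_def additive_frag[OF order_refl]
      by (intro mult_mat_vec_additive) (auto simp: u_vec_def)
  qed
  \<comment> \<open>The triangle is written as a restricted square, the form in which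
    \<open>sum.swap_restrict\<close> applies.\<close>
  also have "\<dots> = (\<Sum>\<tau>\<in>{1..t}. \<Sum>s\<in>{s\<in>{1..t}. s \<le> \<tau>}. (A t \<tau> *\<^sub>v u_vec n u \<tau> s (window \<mu> s \<xi>)) $ i)"
    by (intro sum.cong refl) auto
  also have "\<dots> = (\<Sum>s\<in>{1..t}. \<Sum>\<tau>\<in>{\<tau>\<in>{1..t}. s \<le> \<tau>}. (A t \<tau> *\<^sub>v u_vec n u \<tau> s (window \<mu> s \<xi>)) $ i)"
    by (rule sum.swap_restrict) auto
  also have "\<dots> = (\<Sum>s=1..t. \<Sum>\<tau>=s..t. (A t \<tau> *\<^sub>v u_vec n u \<tau> s (window \<mu> s \<xi>)) $ i)"
    by (intro sum.cong refl) auto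
  finally show ?thesis
    using assms unfolding rhs_def additive_frag[OF order_refl]
    by (simp add: additive_def slack_def sum_subtractf)
qed

text \<open>The order on vectors is entrywise, so each pair \<open>t\<close>, \<open>i\<close>
  yields its own scalar condition and its own dynamic program.\<close>

lemma robust_feasible_iff_slack:
  assumes "multistage_data N \<mu> d m n A \<beta>"
  shows "robust_feasible N \<mu> d m n A \<beta> u \<longleftrightarrow> u \<in> u_space N \<mu> d n \<and>
    (\<forall>t\<in>{1..N}. \<forall>i<m t. \<forall>\<xi>\<in>paths d 1 (int N). (\<Sum>s=1..t. slack n A \<beta> u t s (window \<mu> s \<xi>) i) \<le> 0)"
  unfolding robust_feasible_def
  using constraint_eq_sum_slack[OF assms, symmetric]
  by (auto simp: less_eq_vec_def rhs_def additive_def)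

text \<open>A slack reads only variables in \<open>u_vars\<close>, so it is the same for a point of
  the system and for its \<open>u\<close>-part.\<close>

lemma slack_u_part:
  assumes "t \<in> {1..N}" "s \<in> {1..t}" "\<zeta> \<in> window_paths d \<mu> s"
  shows "slack n A \<beta> (u_part N \<mu> d n v) t s \<zeta> i = slack n A \<beta> v t s \<zeta> i"
proof -
  have "u_vec n (u_part N \<mu> d n v) \<tau> s \<zeta> = u_vec n v \<tau> s \<zeta>" if "\<tau> \<in> {s..t}" for \<tau>
    using assms that by (auto simp: u_vec_def u_part_def u_vars_def)
  then show ?thesis
    by (simp add: slack_def)
qed

section \<open>The linear system as one recursion, and the two directions of the equivalence\<close>

text \<open>Common reading of both families of \<open>z\<close>-variables; for
  \<open>\<mu> = 1\<close> the state is ignored.\<close>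

definition z_val :: "nat \<Rightarrow> assignment \<Rightarrow> nat \<Rightarrow> nat \<Rightarrow> path \<Rightarrow> nat \<Rightarrow> real" where
  "z_val \<mu> v t s \<eta> i = v (if \<mu> = 1 then ZOne t s i else Z t s \<eta> i)"

text \<open>Replaces constraint labels by bounded quantifiers, with \<open>t\<close> and
  \<open>i\<close> outermost because the recursion runs with both fixed.\<close>

lemma ball_indexed:
  fixes k :: "nat \<Rightarrow> nat"
  shows "(\<forall>c\<in>{F t s \<xi> i | t s \<xi> i. t \<in> T \<and> s \<in> S t \<and> \<xi> \<in> W s \<and> i < k t}. Q c)
      \<longleftrightarrow> (\<forall>t\<in>T. \<forall>i<k t. \<forall>s\<in>S t. \<forall>\<xi>\<in>W s. Q (F t s \<xi> i))"
    and "(\<forall>c\<in>{G t \<xi> i | t \<xi> i. t \<in> T \<and> \<xi> \<in> W' t \<and> i < k t}. Q c)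
      \<longleftrightarrow> (\<forall>t\<in>T. \<forall>i<k t. \<forall>\<xi>\<in>W' t. Q (G t \<xi> i))"
    and "(\<forall>c\<in>{H t i | t i. t \<in> T \<and> i < k t}. Q c) \<longleftrightarrow> (\<forall>t\<in>T. \<forall>i<k t. Q (H t i))"
  by blast+

lemma ball_all_conj_distrib:
  fixes k :: "nat \<Rightarrow> nat"
  shows "(\<forall>t\<in>T. \<forall>i<k t. P t i) \<and> (\<forall>t\<in>T. \<forall>i<k t. Q t i) \<longleftrightarrow> (\<forall>t\<in>T. \<forall>i<k t. P t i \<and> Q t i)"
  by blast

text \<open>For \<open>\<mu> = 1\<close> the initial states form the singleton over an empty
  interval, so the last clause is \<open>BInit\<close>. For \<open>\<mu> \<ge> 2\<close> the
  recursion at \<open>s = t\<close> is \<open>CTop\<close> and at \<open>s < t\<close> it is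
  \<open>CStep\<close>.\<close>

lemma satisfies_sys_cons_iff:
  "(\<forall>c\<in>sys_cons N \<mu> d m. satisfies \<mu> n A \<beta> v c) \<longleftrightarrow>
    (\<forall>t\<in>{1..N}. \<forall>i<m t.
      (\<forall>s\<in>{1..t}. \<forall>\<zeta>\<in>window_paths d \<mu> s. v (Y t s \<zeta> i) = slack n A \<beta> v t s \<zeta> i) \<and>
      (\<forall>s\<in>{1..t}. \<forall>\<zeta>\<in>window_paths d \<mu> s.
        v (Y t s \<zeta> i)
          + (if s = t then 0 else z_val \<mu> v t (s + 1) (frag \<zeta> (int s - int \<mu> + 2) (int s)) i)
        \<le> z_val \<mu> v t s (frag \<zeta> (int s - int \<mu> + 1) (int s - 1)) i) \<and>
      (\<forall>\<eta>\<in>paths d (2 - int \<mu>) 0. z_val \<mu> v t 1 \<eta> i \<le> 0))"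
  (is "?L \<longleftrightarrow> ?R")
proof (cases "\<mu> = 1")
  case True
  show ?thesis
    unfolding sys_cons_def if_P[OF True] ball_Un ball_indexed ball_all_conj_distrib
    by (intro ball_cong refl all_cong conj_cong;
        simp add: True slack_def z_val_def paths_empty_interval)
next
  case False
  have split: "(\<forall>s\<in>{1..t}. Q s) \<longleftrightarrow> Q t \<and> (\<forall>s\<in>{1..<t}. Q s)" if "t \<in> {1..N}" for t :: nat and Q
    using that by (auto simp: le_less)
  show ?thesis
    unfolding sys_cons_def if_not_P[OF False] ball_Un ball_indexed ball_all_conj_distrib
  proof (intro ball_cong refl all_cong, goal_cases)
    case (1 t i)
    show ?case
      unfolding split[OF 1(1), of "\<lambda>s. \<forall>\<zeta>\<in>window_paths d \<mu> s. _ s \<zeta> \<le> _ s \<zeta>"]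
      using False by (simp add: slack_def z_val_def conj_assoc)
  qed
qed

text \<open>By (a) the slacks are the \<open>y\<close>-values. Their sum along a scenario is at most
  the \<open>z\<close>-value of its initial state, which the system keeps nonpositive.\<close>

lemma robust_feasible_if_sys_feasible:
  assumes data: "multistage_data N \<mu> d m n A \<beta>" and v: "sys_feasible N \<mu> d m n A \<beta> v"
  shows "robust_feasible N \<mu> d m n A \<beta> (u_part N \<mu> d n v)"
  unfolding robust_feasible_iff_slack[OF data]
proof (intro conjI ballI allI impI)
  show "u_part N \<mu> d n v \<in> u_space N \<mu> d n"
    by (simp add: u_part_def u_space_def)
  fix t i \<xi> assume t: "t \<in> {1..N}" and i: "i < m t" and \<xi>: "\<xi> \<in> paths d 1 (int N)"
  note cons = v[unfolded sys_feasible_def satisfies_sys_cons_iff, THEN conjunct2, rule_format, OF t i]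
  have "(\<Sum>s=1..t. slack n A \<beta> (u_part N \<mu> d n v) t s (window \<mu> s \<xi>) i)
      = (\<Sum>s=1..t. v (Y t s (window \<mu> s \<xi>) i))"
    using cons t by (intro sum.cong refl) (simp add: slack_u_part window_in_window_paths[OF \<xi>])
  also have "\<dots> \<le> z_val \<mu> v t 1 (frag \<xi> (int 1 - int \<mu> + 1) (int 1 - 1)) i"
  proof (rule tail_sum_le_cost_to_go)
    fix s \<zeta> assume "s \<in> {1..t}" "\<zeta> \<in> window_paths d \<mu> s"
    then show "v (Y t s \<zeta> i)
          + (if s = t then 0 else z_val \<mu> v t (s + 1) (frag \<zeta> (int s - int \<mu> + 2) (int s)) i)
        \<le> z_val \<mu> v t s (frag \<zeta> (int s - int \<mu> + 1) (int s - 1)) i"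
      using cons by blast
  qed (use data t \<xi> in \<open>auto simp: multistage_data_def\<close>)
  also have "\<dots> \<le> 0"
  proof -
    have "frag \<xi> (int 1 - int \<mu> + 1) (int 1 - 1) \<in> paths d (2 - int \<mu>) 0"
      using frag_in_paths[of "2 - int \<mu>" 0 \<xi> d] by (simp add: algebra_simps)
    then show ?thesis
      using cons by blast
  qed
  finally show "(\<Sum>s=1..t. slack n A \<beta> (u_part N \<mu> d n v) t s (window \<mu> s \<xi>) i) \<le> 0" .
qed

text \<open>The \<open>y\<close>-variables are set to the slacks and the \<open>z\<close>-variables
  to the cost-to-go functions of the separate dynamic programs.\<close>

lemma sys_feasible_extension:
  assumes data: "multistage_data N \<mu> d m n A \<beta>" and u: "robust_feasible N \<mu> d m n A \<beta> u"
  obtains v where "u_part N \<mu> d n v = u" "sys_feasible N \<mu> d m n A \<beta> v"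
proof -
  have "\<exists>z. (\<forall>s\<in>{1..t}. \<forall>\<zeta>\<in>window_paths d \<mu> s.
      slack n A \<beta> u t s \<zeta> i + (if s = t then 0 else z (s + 1) (frag \<zeta> (int s - int \<mu> + 2) (int s)))
        \<le> z s (frag \<zeta> (int s - int \<mu> + 1) (int s - 1))) \<and>
      (\<forall>\<eta>\<in>paths d (2 - int \<mu>) 0. z 1 \<eta> \<le> (0::real))" if "t \<in> {1..N}" "i < m t" for t i
  proof -
    have "(\<Sum>s=1..t. slack n A \<beta> u t s (window \<mu> s \<xi>) i) \<le> 0" if "\<xi> \<in> paths d 1 (int N)" for \<xi>
      using u that \<open>t \<in> {1..N}\<close> \<open>i < m t\<close> unfolding robust_feasible_iff_slack[OF data] by blast
    then show ?thesis
      by (rule cost_to_go_exists) (use data that in \<open>auto simp: multistage_data_def\<close>)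
  qed
  then obtain z :: "nat \<Rightarrow> nat \<Rightarrow> nat \<Rightarrow> path \<Rightarrow> real" where
    z: "\<And>t i s \<zeta>. t \<in> {1..N} \<Longrightarrow> i < m t \<Longrightarrow> s \<in> {1..t} \<Longrightarrow> \<zeta> \<in> window_paths d \<mu> s \<Longrightarrow>
      slack n A \<beta> u t s \<zeta> i + (if s = t then 0 else z t i (s + 1) (frag \<zeta> (int s - int \<mu> + 2) (int s)))
        \<le> z t i s (frag \<zeta> (int s - int \<mu> + 1) (int s - 1))"
    and z1: "\<And>t i \<eta>. t \<in> {1..N} \<Longrightarrow> i < m t \<Longrightarrow> \<eta> \<in> paths d (2 - int \<mu>) 0 \<Longrightarrow> z t i 1 \<eta> \<le> 0"
    by metis
  \<comment> \<open>\<open>ZOne\<close> carries no state, so it takes the value at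
    \<open>\<lambda>_. undefined\<close>, the only state for \<open>\<mu> = 1\<close>.\<close>
  define v where "v = (\<lambda>k\<in>sys_vars N \<mu> d m n. case k of
      U _ _ _ _ \<Rightarrow> u k
    | Y t s \<zeta> i \<Rightarrow> slack n A \<beta> u t s \<zeta> i
    | ZOne t s i \<Rightarrow> z t i s (\<lambda>_. undefined)
    | Z t s \<eta> i \<Rightarrow> z t i s \<eta>)"
  have U: "v k = u k" if "k \<in> u_vars N \<mu> d n" for k
    using that by (auto simp: v_def sys_vars_def u_vars_def)
  have v_u: "u_part N \<mu> d n v = u"
    using u by (auto simp: U u_part_def robust_feasible_def u_space_def PiE_iff extensional_def)
  \<comment> \<open>The first equation is constraint (a), evaluated at \<open>v\<close> itself; the
    second feeds the recursion for \<open>z\<close>, which was built from \<open>u\<close>.\<close>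
  have Y: "v (Y t s \<zeta> i) = slack n A \<beta> v t s \<zeta> i"
    "v (Y t s \<zeta> i) = slack n A \<beta> u t s \<zeta> i"
    if "t \<in> {1..N}" "s \<in> {1..t}" "\<zeta> \<in> window_paths d \<mu> s" "i < m t" for t s \<zeta> i
    using that slack_u_part[OF that(1-3), of n A \<beta> v i] unfolding v_u
    by (auto simp: v_def sys_vars_def y_vars_def)
  have Z: "z_val \<mu> v t s \<eta> i = z t i s \<eta>"
    if "t \<in> {1..N}" "s \<in> {1..t}" "\<eta> \<in> paths d (int s - int \<mu> + 1) (int s - 1)" "i < m t" for t s \<eta> i
    using that by (auto simp: z_val_def v_def sys_vars_def z_vars_def paths_empty_interval)
  have "sys_feasible N \<mu> d m n A \<beta> v"
    unfolding sys_feasible_def satisfies_sys_cons_iff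
  proof (intro conjI ballI allI impI)
    show "v \<in> sys_vars N \<mu> d m n \<rightarrow>\<^sub>E UNIV"
      by (simp add: v_def)
  next
    fix t i s \<zeta> assume *: "t \<in> {1..N}" "i < m t" "s \<in> {1..t}" "\<zeta> \<in> window_paths d \<mu> s"
    then show "v (Y t s \<zeta> i) = slack n A \<beta> v t s \<zeta> i"
      by (intro Y)
    have "frag \<zeta> (int s - int \<mu> + 1) (int s - 1) \<in> paths d (int s - int \<mu> + 1) (int s - 1)"
      by (intro frag_in_paths paths_apply[OF *(4)[unfolded window_paths_def]]) auto
    then have "z_val \<mu> v t s (frag \<zeta> (int s - int \<mu> + 1) (int s - 1)) i
        = z t i s (frag \<zeta> (int s - int \<mu> + 1) (int s - 1))"
      using * by (intro Z)
    \<comment> \<open>Only for \<open>s \<noteq> t\<close> is \<open>s + 1\<close> still at most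
      \<open>t\<close>, hence the index of a variable of the system.\<close>
    moreover have "z_val \<mu> v t (s + 1) (frag \<zeta> (int s - int \<mu> + 2) (int s)) i
        = z t i (s + 1) (frag \<zeta> (int s - int \<mu> + 2) (int s))" if "s \<noteq> t"
    proof -
      have "frag \<zeta> (int s - int \<mu> + 2) (int s) \<in> paths d (int s - int \<mu> + 2) (int s)"
        by (intro frag_in_paths paths_apply[OF *(4)[unfolded window_paths_def]]) auto
      then show ?thesis
        using * that Z[of t "s + 1" "frag \<zeta> (int s - int \<mu> + 2) (int s)" i]
        by (simp add: algebra_simps)
    qed
    ultimately show "v (Y t s \<zeta> i)
          + (if s = t then 0 else z_val \<mu> v t (s + 1) (frag \<zeta> (int s - int \<mu> + 2) (int s)) i)
        \<le> z_val \<mu> v t s (frag \<zeta> (int s - int \<mu> + 1) (int s - 1)) i"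
      using z[OF *] Y(2)[OF *(1,3,4,2)] by (simp split: if_splits)
  next
    fix t i \<eta> assume *: "t \<in> {1..N}" "i < m t" "\<eta> \<in> paths d (2 - int \<mu>) 0"
    then have "z_val \<mu> v t 1 \<eta> i = z t i 1 \<eta>"
      by (intro Z) (auto simp: algebra_simps)
    then show "z_val \<mu> v t 1 \<eta> i \<le> 0"
      using z1[OF *] by simp
  qed
  with v_u show ?thesis by (rule that)
qed

section \<open>Transfer of the optimization problem\<close>

text \<open>The set \<open>R\<close> is the image of \<open>S\<close> under \<open>p\<close>, and
  the lifted objective factors through \<open>p\<close>. Extended reals give the infimum a meaning
  also for empty feasible sets and unbounded objectives.\<close>

lemma INF_and_arg_min_projection:
  fixes f :: "'a \<Rightarrow> real" and p :: "'b \<Rightarrow> 'a"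
  assumes "\<And>u. R u \<longleftrightarrow> (\<exists>v. p v = u \<and> S v)"
  shows "(INF u\<in>{u. R u}. ereal (f u)) = (INF v\<in>{v. S v}. ereal (f (p v)))"
    and "is_arg_min f R u \<longleftrightarrow> (\<exists>v. p v = u \<and> is_arg_min (\<lambda>v. f (p v)) S v)"
proof -
  have "{u. R u} = p ` {v. S v}"
    using assms by auto
  then show "(INF u\<in>{u. R u}. ereal (f u)) = (INF v\<in>{v. S v}. ereal (f (p v)))"
    by (simp add: image_image)
  show "is_arg_min f R u \<longleftrightarrow> (\<exists>v. p v = u \<and> is_arg_min (\<lambda>v. f (p v)) S v)"
    unfolding is_arg_min_def assms by blast
qed

section \<open>Counting variables and constraints\<close>

text \<open>Nonpositive stages contribute a factor 1, at most \<open>D\<close>. Since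
  \<open>k\<close> may exceed the length of the interval, windows and states share the bound with
  exponent \<open>\<mu>\<close>.\<close>

lemma card_paths_le:
  assumes "\<forall>t\<in>{1..N}. d t \<le> D" "1 \<le> D" "q \<le> int N" "nat (q - p + 1) \<le> k"
  shows "card (paths d p q) \<le> D ^ k"
proof -
  have "card (stage_set d s) \<le> D" if "s \<in> {p..q}" for s
  proof (cases "s \<le> 0")
    case False
    then have "nat s \<in> {1..N}" using that assms(3) by auto
    then show ?thesis using assms(1) False by (auto simp: stage_set_def)
  qed (use assms(2) in \<open>simp add: stage_set_def\<close>)
  then have "card (paths d p q) \<le> (\<Prod>s\<in>{p..q}. D)"
    unfolding paths_def by (simp only: card_PiE finite_atLeastAtMost_int) (intro prod_mono; simp)
  also have "\<dots> \<le> D ^ k"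
    using assms(2,4) by (simp add: power_increasing)
  finally show ?thesis .
qed

lemma card_Un_le_add: "card A \<le> a \<Longrightarrow> card B \<le> b \<Longrightarrow> card (A \<union> B) \<le> a + b"
  by (rule order_trans[OF card_Un_le add_mono])

text \<open>The family lies in the image of a product with \<open>N\<close> choices of
  \<open>t\<close>, at most \<open>N * K\<close> of \<open>(s, \<xi>)\<close> and \<open>M\<close>
  of \<open>i\<close>. Families lacking \<open>s\<close> or \<open>\<xi>\<close> are covered by
  singletons for \<open>S\<close> or \<open>W\<close>.\<close>

lemma card_indexed_le:
  fixes W :: "nat \<Rightarrow> path set" and k :: "nat \<Rightarrow> nat"
  assumes "\<And>t. t \<in> {1..N} \<Longrightarrow> S t \<subseteq> {1..N}" "\<And>t. t \<in> {1..N} \<Longrightarrow> k t \<le> M"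
    and "\<And>s. s \<in> {1..N} \<Longrightarrow> finite (W s)" "\<And>s. s \<in> {1..N} \<Longrightarrow> card (W s) \<le> K"
  shows "finite {F t s \<xi> i | t s \<xi> i. t \<in> {1..N} \<and> s \<in> S t \<and> \<xi> \<in> W s \<and> i < k t}" (is "finite ?X")
    and "card {F t s \<xi> i | t s \<xi> i. t \<in> {1..N} \<and> s \<in> S t \<and> \<xi> \<in> W s \<and> i < k t} \<le> M * (N^2 * K)"
proof -
  let ?I = "{1..N} \<times> (SIGMA s:{1..N}. W s) \<times> {..<M}"
  have fin: "finite ?I"
    using assms(3) by (intro finite_cartesian_product finite_SigmaI) auto
  have sub: "?X \<subseteq> (\<lambda>(t, (s, \<xi>), i). F t s \<xi> i) ` ?I"
  proof clarify
    fix t s \<xi> i assume "t \<in> {1..N}" "s \<in> S t" "\<xi> \<in> W s" "i < k t"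
    then show "F t s \<xi> i \<in> (\<lambda>(t, (s, \<xi>), i). F t s \<xi> i) ` ?I"
      using assms(1)[of t] assms(2)[of t] by (intro image_eqI[of _ _ "(t, (s, \<xi>), i)"]) auto
  qed
  show "finite ?X"
    using sub finite_imageI[OF fin] by (rule finite_subset)
  have "card ?X \<le> card ?I"
    using fin sub by (rule surj_card_le)
  also have "\<dots> = N * ((\<Sum>s=1..N. card (W s)) * M)"
    using assms(3) by (simp add: card_cartesian_product)
  also have "(\<Sum>s=1..N. card (W s)) \<le> N * K"
    using sum_bounded_above[of "{1..N}" "\<lambda>s. card (W s)" K] assms(4) by simp
  finally show "card ?X \<le> M * (N^2 * K)"
    by (simp add: power2_eq_square mult.assoc mult.left_commute mult.commute)
qed

lemma system_size:
  assumes data: "multistage_data N \<mu> d m n A \<beta>"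
    and bounds: "\<forall>t\<in>{1..N}. d t \<le> D \<and> m t \<le> m' \<and> n t \<le> n'"
  shows "finite (sys_vars N \<mu> d m n)" "card (sys_vars N \<mu> d m n) \<le> 4 * ((m' + n') * (N^2 * D^\<mu>))"
    and "finite (sys_cons N \<mu> d m)" "card (sys_cons N \<mu> d m) \<le> 4 * ((m' + n') * (N^2 * D^\<mu>))"
proof -
  let ?B = "N^2 * D^\<mu>"
  have "N \<ge> 1" "\<mu> \<ge> 1"
    using data by (auto simp: multistage_data_def)
  \<comment> \<open>Stage 1 exists because \<open>N \<ge> 1\<close>, so \<open>D\<close> bounds some
    \<open>d t \<ge> 1\<close>.\<close>
  moreover have "1 \<le> d 1"
    using data by (auto simp: multistage_data_def)
  ultimately have D: "1 \<le> D"
    using bounds by force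
  have W: "finite (window_paths d \<mu> s)" "s \<in> {1..N} \<Longrightarrow> card (window_paths d \<mu> s) \<le> D ^ \<mu>" for s
    using bounds D by (auto simp: window_paths_def finite_paths intro!: card_paths_le[where N = N])
  have W': "finite (paths d (int s - int \<mu> + 1) (int s - 1))"
    "s \<in> {1..N} \<Longrightarrow> card (paths d (int s - int \<mu> + 1) (int s - 1)) \<le> D ^ \<mu>" for s
    using bounds D by (auto simp: finite_paths intro!: card_paths_le[where N = N])
  have W0: "finite (paths d (2 - int \<mu>) 0)" "card (paths d (2 - int \<mu>) 0) \<le> D ^ \<mu>"
    using bounds D by (auto simp: finite_paths intro!: card_paths_le[where N = N])
  have one: "card {\<lambda>_::int. undefined :: nat} \<le> D ^ \<mu>"
    using D by simp
  have u: "finite (u_vars N \<mu> d n)" "card (u_vars N \<mu> d n) \<le> n' * ?B"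
    unfolding u_vars_def by (rule card_indexed_le; use bounds W in auto)+
  have y: "finite (y_vars N \<mu> d m)" "card (y_vars N \<mu> d m) \<le> m' * ?B"
    unfolding y_vars_def by (rule card_indexed_le; use bounds W in auto)+
  have z1: "finite {ZOne t s i | t s i. t \<in> {1..N} \<and> s \<in> {1..t} \<and> i < m t}"
      "card {ZOne t s i | t s i. t \<in> {1..N} \<and> s \<in> {1..t} \<and> i < m t} \<le> m' * ?B"
    using card_indexed_le[of N "\<lambda>t. {1..t}" m m' "\<lambda>_. {\<lambda>_. undefined}" "D ^ \<mu>"
        "\<lambda>t s _ i. ZOne t s i"] bounds one by auto
  have z2: "finite {Z t s \<eta> i | t s \<eta> i. t \<in> {1..N} \<and> s \<in> {1..t} \<and>
              \<eta> \<in> paths d (int s - int \<mu> + 1) (int s - 1) \<and> i < m t}"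
      "card {Z t s \<eta> i | t s \<eta> i. t \<in> {1..N} \<and> s \<in> {1..t} \<and>
              \<eta> \<in> paths d (int s - int \<mu> + 1) (int s - 1) \<and> i < m t} \<le> m' * ?B"
    by (rule card_indexed_le; use bounds W' in auto)+
  have z: "finite (z_vars N \<mu> d m)" "card (z_vars N \<mu> d m) \<le> m' * ?B"
    unfolding z_vars_def by (split if_split, intro conjI impI z1 z2)+
  show "finite (sys_vars N \<mu> d m n)"
    using u y z by (simp add: sys_vars_def)
  have "card (sys_vars N \<mu> d m n) \<le> n' * ?B + m' * ?B + m' * ?B"
    unfolding sys_vars_def by (intro card_Un_le_add u y z)
  then show "card (sys_vars N \<mu> d m n) \<le> 4 * ((m' + n') * ?B)"
    by (simp add: algebra_simps)
  let ?yd = "{YDef t s \<xi> i | t s \<xi> i. t \<in> {1..N} \<and> s \<in> {1..t} \<and> \<xi> \<in> window_paths d \<mu> s \<and> i < m t}"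
  let ?bs = "{BStep t s \<xi> i | t s \<xi> i. t \<in> {1..N} \<and> s \<in> {1..t} \<and> \<xi> \<in> window_paths d \<mu> s \<and> i < m t}"
  let ?bi = "{BInit t i | t i. t \<in> {1..N} \<and> i < m t}"
  let ?ct = "{CTop t \<xi> i | t \<xi> i. t \<in> {1..N} \<and> \<xi> \<in> window_paths d \<mu> t \<and> i < m t}"
  let ?cs = "{CStep t s \<xi> i | t s \<xi> i. t \<in> {1..N} \<and> s \<in> {1..<t} \<and> \<xi> \<in> window_paths d \<mu> s \<and> i < m t}"
  let ?ci = "{CInit t \<eta> i | t \<eta> i. t \<in> {1..N} \<and> \<eta> \<in> paths d (2 - int \<mu>) 0 \<and> i < m t}"
  have yd: "finite ?yd" "card ?yd \<le> m' * ?B"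
    by (rule card_indexed_le; use bounds W in auto)+
  have bs: "finite ?bs" "card ?bs \<le> m' * ?B"
    by (rule card_indexed_le; use bounds W in auto)+
  have bi: "finite ?bi" "card ?bi \<le> m' * ?B"
    using card_indexed_le[of N "\<lambda>t. {1}" m m' "\<lambda>_. {\<lambda>_. undefined}" "D ^ \<mu>"
        "\<lambda>t s _ i. BInit t i"] bounds one by auto
  \<comment> \<open>Choosing \<open>{t}\<close> as the range of \<open>s\<close> makes the window at
    \<open>s\<close> the window at \<open>t\<close>.\<close>
  have ct: "finite ?ct" "card ?ct \<le> m' * ?B"
    using card_indexed_le[of N "\<lambda>t. {t}" m m' "window_paths d \<mu>" "D ^ \<mu>"
        "\<lambda>t s \<xi> i. CTop t \<xi> i"] bounds W by auto
  have cs: "finite ?cs" "card ?cs \<le> m' * ?B"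
    by (rule card_indexed_le; use bounds W in auto)+
  have ci: "finite ?ci" "card ?ci \<le> m' * ?B"
    using card_indexed_le[of N "\<lambda>t. {1}" m m' "\<lambda>_. paths d (2 - int \<mu>) 0" "D ^ \<mu>"
        "\<lambda>t s \<xi> i. CInit t \<xi> i"] bounds W0 by auto
  show "finite (sys_cons N \<mu> d m)"
    unfolding sys_cons_def by (split if_split, intro conjI impI finite_UnI yd bs bi ct cs ci)
  have "card (sys_cons N \<mu> d m) \<le> m' * ?B + (m' * ?B + m' * ?B + m' * ?B)"
  proof (cases "\<mu> = 1")
    case True
    have "card (?yd \<union> (?bs \<union> ?bi)) \<le> m' * ?B + (m' * ?B + m' * ?B)"
      by (intro card_Un_le_add yd bs bi)
    also have "\<dots> \<le> m' * ?B + (m' * ?B + m' * ?B + m' * ?B)"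
      by simp
    finally show ?thesis
      unfolding sys_cons_def if_P[OF True] .
  next
    case False
    have "card (?yd \<union> (?ct \<union> ?cs \<union> ?ci)) \<le> m' * ?B + (m' * ?B + m' * ?B + m' * ?B)"
      by (intro card_Un_le_add yd ct cs ci)
    then show ?thesis
      unfolding sys_cons_def if_not_P[OF False] .
  qed
  then show "card (sys_cons N \<mu> d m) \<le> 4 * ((m' + n') * ?B)"
    by (simp add: algebra_simps)
qed

theorem mainTheorem1:
  shows "\<exists>C::real. \<forall>N \<mu> d m n A \<beta>. multistage_data N \<mu> d m n A \<beta> \<longrightarrow>
    (\<forall>u \<in> u_space N \<mu> d n.
       robust_feasible N \<mu> d m n A \<beta> u \<longleftrightarrow>
       (\<exists>v. u_part N \<mu> d n v = u \<and> sys_feasible N \<mu> d m n A \<beta> v)) \<and>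
    (\<forall>f. convex_objective (u_vars N \<mu> d n) f \<longrightarrow>
       (INF u\<in>{u. robust_feasible N \<mu> d m n A \<beta> u}. ereal (f u)) =
       (INF v\<in>{v. sys_feasible N \<mu> d m n A \<beta> v}. ereal (f (u_part N \<mu> d n v))) \<and>
       (\<forall>u. is_arg_min f (robust_feasible N \<mu> d m n A \<beta>) u \<longleftrightarrow>
          (\<exists>v. u_part N \<mu> d n v = u \<and>
             is_arg_min (\<lambda>v. f (u_part N \<mu> d n v)) (sys_feasible N \<mu> d m n A \<beta>) v))) \<and>
    (\<forall>d' m' n' :: nat. (\<forall>t\<in>{1..N}. d t \<le> d' \<and> m t \<le> m' \<and> n t \<le> n') \<longrightarrow>
       finite (sys_vars N \<mu> d m n) \<and>
       real (card (sys_vars N \<mu> d m n)) \<le> C * real (m' + n') * real N ^ 2 * real d' ^ \<mu> \<and>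
       finite (sys_cons N \<mu> d m) \<and>
       real (card (sys_cons N \<mu> d m)) \<le> C * real (m' + n') * real N ^ 2 * real d' ^ \<mu>)"
proof (intro exI[of _ "4::real"] allI impI)
  \<comment> \<open>The constant 4 comes from the constraints: (a) is one family, (c) has three and
    (b) two, each of size at most \<open>m' * (N^2 * d'^\<mu>)\<close>.\<close>
  fix N \<mu> d m n A \<beta> assume data: "multistage_data N \<mu> d m n A \<beta>"
  let ?R = "robust_feasible N \<mu> d m n A \<beta>" and ?S = "sys_feasible N \<mu> d m n A \<beta>"
  let ?p = "u_part N \<mu> d n"
  \<comment> \<open>This holds for every \<open>u\<close>, since either side forces \<open>u\<close>
    into \<open>u_space\<close>; the statement on minimizers uses it in this generality.\<close>
  have iff: "?R u \<longleftrightarrow> (\<exists>v. ?p v = u \<and> ?S v)" for u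
    using robust_feasible_if_sys_feasible[OF data] sys_feasible_extension[OF data] by metis
  have size: "finite (sys_vars N \<mu> d m n) \<and>
      real (card (sys_vars N \<mu> d m n)) \<le> 4 * real (m' + n') * real N ^ 2 * real d' ^ \<mu> \<and>
      finite (sys_cons N \<mu> d m) \<and>
      real (card (sys_cons N \<mu> d m)) \<le> 4 * real (m' + n') * real N ^ 2 * real d' ^ \<mu>"
    if "\<forall>t\<in>{1..N}. d t \<le> d' \<and> m t \<le> m' \<and> n t \<le> n'" for d' m' n'
  proof -
    note sz = system_size[OF data that]
    have "4 * real (m' + n') * real N ^ 2 * real d' ^ \<mu> = real (4 * ((m' + n') * (N^2 * d'^\<mu>)))"
      by simp
    then show ?thesis
      using sz by (simp only: of_nat_le_iff)
  qed
  show "(\<forall>u \<in> u_space N \<mu> d n. ?R u \<longleftrightarrow> (\<exists>v. ?p v = u \<and> ?S v)) \<and>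
    (\<forall>f. convex_objective (u_vars N \<mu> d n) f \<longrightarrow>
       (INF u\<in>{u. ?R u}. ereal (f u)) = (INF v\<in>{v. ?S v}. ereal (f (?p v))) \<and>
       (\<forall>u. is_arg_min f ?R u \<longleftrightarrow> (\<exists>v. ?p v = u \<and> is_arg_min (\<lambda>v. f (?p v)) ?S v))) \<and>
    (\<forall>d' m' n' :: nat. (\<forall>t\<in>{1..N}. d t \<le> d' \<and> m t \<le> m' \<and> n t \<le> n') \<longrightarrow>
       finite (sys_vars N \<mu> d m n) \<and>
       real (card (sys_vars N \<mu> d m n)) \<le> 4 * real (m' + n') * real N ^ 2 * real d' ^ \<mu> \<and>
       finite (sys_cons N \<mu> d m) \<and>
       real (card (sys_cons N \<mu> d m)) \<le> 4 * real (m' + n') * real N ^ 2 * real d' ^ \<mu>)"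
  proof (intro conjI)
    show "\<forall>u \<in> u_space N \<mu> d n. ?R u \<longleftrightarrow> (\<exists>v. ?p v = u \<and> ?S v)"
      using iff by blast
    show "\<forall>f. convex_objective (u_vars N \<mu> d n) f \<longrightarrow>
       (INF u\<in>{u. ?R u}. ereal (f u)) = (INF v\<in>{v. ?S v}. ereal (f (?p v))) \<and>
       (\<forall>u. is_arg_min f ?R u \<longleftrightarrow> (\<exists>v. ?p v = u \<and> is_arg_min (\<lambda>v. f (?p v)) ?S v))"
      by (intro allI impI conjI INF_and_arg_min_projection iff)
  qed (intro allI impI size)
qed

end
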